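(* Let $(A,d_A)$ be a differential algebra of weight $\lambda$ and let $(V,d_V)$ be a bimodule over $(A,d_A)$. The pair $(C^*_{\mathsf{DA}_\lambda}(A,V),\partial_{\mathsf{DA}_\lambda})$ is a cochain complex, i.e. $\partial_{\mathsf{DA}_\lambda}^2=0$.
   Context: Throughout, $\mathbf{k}$ is a field of characteristic zero; all vector spaces, algebras, linear maps and tensor products are over $\mathbf{k}$. Fix $\lambda\in\mathbf{k}$. A differential algebra of weight $\lambda$ is an associative algebra $A$ with a linear operator $d_A:A\to A$ such that $d_A(xy)=d_A(x)y+xd_A(y)+\lambda d_A(x)d_A(y)$ for all $x,y\in A$; if $A$ is unital one further requires $d_A(1_A)=0$. A bimodule over $(A,d_A)$ is a bimodule $V$ over the associative algebra $A$ (left action $xv$, right action $vx$) with $d_V\in\mathrm{End}_{\mathbf{k}}(V)$ such that $d_V(xv)=d_A(x)v+xd_V(v)+\lambda d_A(x)d_V(v)$ and $d_V(vx)=vd_A(x)+d_V(v)x+\lambda d_V(v)d_A(x)$ for all $x\in A,v\in V$. The formulas $x\vdash_\lambda v=(x+\lambda d_A(x))v$, $v\dashv_\lambda x=v(x+\lambda d_A(x))$ define another bimodule structure on $(V,d_V)$ over $(A,d_A)$. Set $C^n_{\mathsf{Alg}}(A,V)=C^n_{\mathsf{DO}_\lambda}(d_A,d_V)=\mathrm{Hom}(A^{\otimes n},V)$ for $n\ge0$ (equal to $V$ for $n=0$). The operator $\partial:C^n_{\mathsf{Alg}}(A,V)\to C^{n+1}_{\mathsf{Alg}}(A,V)$ is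 the Hochschild coboundary $$\partial f(x_1,\dots,x_{n+1})=x_1f(x_2,\dots,x_{n+1})+\sum_{i=1}^n(-1)^if(x_1,\dots,x_ix_{i+1},\dots,x_{n+1})+(-1)^{n+1}f(x_1,\dots,x_n)x_{n+1},$$ and $\partial_\lambda:C^n_{\mathsf{DO}_\lambda}(d_A,d_V)\to C^{n+1}_{\mathsf{DO}_\lambda}(d_A,d_V)$ is $$\partial_\lambda f(x_1,\dots,x_{n+1})=x_1\vdash_\lambda f(x_2,\dots,x_{n+1})+\sum_{i=1}^n(-1)^if(x_1,\dots,x_ix_{i+1},\dots,x_{n+1})+(-1)^{n+1}f(x_1,\dots,x_n)\dashv_\lambda x_{n+1}.$$ The linear map $\delta:C^n_{\mathsf{Alg}}(A,V)\to C^n_{\mathsf{DO}_\lambda}(d_A,d_V)$ is defined for $n\ge1$ by $$\delta f(x_1,\dots,x_n)=\sum_{k=1}^n\lambda^{k-1}\sum_{1\le i_1<\cdots<i_k\le n}f(x_1,\dots,d_A(x_{i_1}),\dots,d_A(x_{i_k}),\dots,x_n)-d_V(f(x_1,\dots,x_n)),$$ and for $n=0$ by $\delta v=-d_V(v)$. Define $C^0_{\mathsf{DA}_\lambda}(A,V)=C^0_{\mathsf{Alg}}(A,V)=V$ and $C^n_{\mathsf{DA}_\lambda}(A,V)=C^n_{\mathsf{Alg}}(A,V)\oplus C^{n-1}_{\mathsf{DO}_\lambda}(d_A,d_V)$ for $n\ge1$. The linear map $\partial_{\mathsf{DA}_\lambda}:C^n_{\mathsf{DA}_\lambda}(A,V)\to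 C^{n+1}_{\mathsf{DA}_\lambda}(A,V)$ is $\partial_{\mathsf{DA}_\lambda}(f,g)=(\partial f,\ \partial_\lambda g+(-1)^n\delta f)$ for $f\in C^n_{\mathsf{Alg}}(A,V)$, $g\in C^{n-1}_{\mathsf{DO}_\lambda}(d_A,d_V)$, $n\ge1$, and $\partial_{\mathsf{DA}_\lambda}v=(\partial v,\delta v)$ for $v\in V$. *)

theory Defs
  imports Complex_Main "HOL-Library.Function_Algebras" "HOL-Library.Product_Plus"
begin

text \<open>
  Algebras are associative but not assumed to have a unit, hence the class \<open>ring\<close> (and not
  \<open>ring_1\<close>) for the carrier type.
\<close>

locale assoc_algebra = A: vector_space scaleA
  for scaleA :: "'k::field_char_0 \<Rightarrow> 'a::ring \<Rightarrow> 'a" +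
  assumes scale_mult_left: "scaleA c x * y = scaleA c (x * y)"
    and scale_mult_right: "x * scaleA c y = scaleA c (x * y)"

locale differential_algebra = assoc_algebra scaleA
  for scaleA :: "'k::field_char_0 \<Rightarrow> 'a::ring \<Rightarrow> 'a" +
  fixes lam :: 'k and dA :: "'a \<Rightarrow> 'a"
  assumes linear_dA: "Vector_Spaces.linear scaleA scaleA dA"
    and dA_mult: "dA (x * y) = dA x * y + x * dA y + scaleA lam (dA x * dA y)"
    and dA_unit: "(\<And>x. e * x = x \<and> x * e = x) \<Longrightarrow> dA e = 0"

text \<open>
  The actions are written \<open>lact x v\<close> for $xv$ and \<open>ract v x\<close> for $vx$.  No unitality of the actions
  is required, even when the algebra happens to have a unit.
\<close>

locale assoc_bimodule = assoc_algebra scaleA + V: vector_space scaleV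
  for scaleA :: "'k::field_char_0 \<Rightarrow> 'a::ring \<Rightarrow> 'a"
    and scaleV :: "'k \<Rightarrow> 'v::ab_group_add \<Rightarrow> 'v" +
  fixes lact :: "'a \<Rightarrow> 'v \<Rightarrow> 'v" and ract :: "'v \<Rightarrow> 'a \<Rightarrow> 'v"
  assumes lact_linear_left: "Vector_Spaces.linear scaleA scaleV (\<lambda>x. lact x v)"
    and lact_linear_right: "Vector_Spaces.linear scaleV scaleV (\<lambda>v. lact x v)"
    and ract_linear_left: "Vector_Spaces.linear scaleV scaleV (\<lambda>v. ract v x)"
    and ract_linear_right: "Vector_Spaces.linear scaleA scaleV (\<lambda>x. ract v x)"
    and lact_mult: "lact (x * y) v = lact x (lact y v)"
    and ract_mult: "ract v (x * y) = ract (ract v x) y"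
    and lact_ract: "ract (lact x v) y = lact x (ract v y)"

locale differential_bimodule =
  differential_algebra scaleA lam dA + assoc_bimodule scaleA scaleV lact ract
  for scaleA :: "'k::field_char_0 \<Rightarrow> 'a::ring \<Rightarrow> 'a"
    and lam :: 'k and dA :: "'a \<Rightarrow> 'a"
    and scaleV :: "'k \<Rightarrow> 'v::ab_group_add \<Rightarrow> 'v"
    and lact :: "'a \<Rightarrow> 'v \<Rightarrow> 'v" and ract :: "'v \<Rightarrow> 'a \<Rightarrow> 'v" +
  fixes dV :: "'v \<Rightarrow> 'v"
  assumes linear_dV: "Vector_Spaces.linear scaleV scaleV dV"
    and dV_lact: "dV (lact x v) = lact (dA x) v + lact x (dV v) + scaleV lam (lact (dA x) (dV v))"
    and dV_ract: "dV (ract v x) = ract v (dA x) + ract (dV v) x + scaleV lam (ract (dV v) (dA x))"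

definition lact_lam ::
    "('k \<Rightarrow> 'a::ring \<Rightarrow> 'a) \<Rightarrow> 'k \<Rightarrow> ('a \<Rightarrow> 'a) \<Rightarrow> ('a \<Rightarrow> 'v \<Rightarrow> 'v) \<Rightarrow> 'a \<Rightarrow> 'v \<Rightarrow> 'v" where
  "lact_lam scaleA lam dA lact x v = lact (x + scaleA lam (dA x)) v"

definition ract_lam ::
    "('k \<Rightarrow> 'a::ring \<Rightarrow> 'a) \<Rightarrow> 'k \<Rightarrow> ('a \<Rightarrow> 'a) \<Rightarrow> ('v \<Rightarrow> 'a \<Rightarrow> 'v) \<Rightarrow> 'v \<Rightarrow> 'a \<Rightarrow> 'v" where
  "ract_lam scaleA lam dA ract v x = ract v (x + scaleA lam (dA x))"

text \<open>
  $\mathrm{Hom}(A^{\otimes n}, V)$ is the space of $n$-multilinear maps.  An $n$-cochain is a function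
  on lists of arguments, with the value $f(x_1, \dots, x_n)$ at \<open>[x\<^sub>1, \<dots>, x\<^sub>n]\<close>; it is normalised
  to be \<open>0\<close> on lists of any other length, so that equality of cochains is equality of functions.
\<close>

definition cochains ::
    "('k::field \<Rightarrow> 'a::ab_group_add \<Rightarrow> 'a) \<Rightarrow> ('k \<Rightarrow> 'v::ab_group_add \<Rightarrow> 'v) \<Rightarrow> nat \<Rightarrow> ('a list \<Rightarrow> 'v) set"
  where
  "cochains scaleA scaleV n =
     {f. (\<forall>xs i. length xs = n \<longrightarrow> i < n \<longrightarrow>
              Vector_Spaces.linear scaleA scaleV (\<lambda>x. f (xs[i := x]))) \<and>
         (\<forall>xs. length xs \<noteq> n \<longrightarrow> f xs = 0)}"

text \<open>In degree 0 this is a copy of $V$, embedded by the values at the empty list.\<close>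

lemma cochains_0: "bij_betw (\<lambda>f. f []) (cochains scaleA scaleV 0) UNIV"
proof (rule bij_betw_byWitness[where f' = "\<lambda>v xs. if xs = [] then v else 0"])
qed (auto simp: cochains_def fun_eq_iff)

text \<open>
  List positions count from 0: \<open>xs ! i\<close> is $x_{i+1}$, and the summand with index \<open>i\<close> below is the
  one in which $x_{i+1}$ and $x_{i+2}$ are multiplied.
\<close>

definition hochschild ::
    "('k::field \<Rightarrow> 'v::ab_group_add \<Rightarrow> 'v) \<Rightarrow> ('a::ring \<Rightarrow> 'v \<Rightarrow> 'v) \<Rightarrow> ('v \<Rightarrow> 'a \<Rightarrow> 'v) \<Rightarrow>
     nat \<Rightarrow> ('a list \<Rightarrow> 'v) \<Rightarrow> 'a list \<Rightarrow> 'v" where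
  "hochschild scaleV lact ract n f xs =
     (if length xs = Suc n then
        lact (xs ! 0) (f (drop 1 xs))
        + (\<Sum>i<n. scaleV ((- 1) ^ (i + 1))
                    (f (take i xs @ [xs ! i * xs ! (i + 1)] @ drop (i + 2) xs)))
        + scaleV ((- 1) ^ (n + 1)) (ract (f (take n xs)) (xs ! n))
      else 0)"

definition hochschild_lam ::
    "('k::field \<Rightarrow> 'a::ring \<Rightarrow> 'a) \<Rightarrow> 'k \<Rightarrow> ('a \<Rightarrow> 'a) \<Rightarrow> ('k \<Rightarrow> 'v::ab_group_add \<Rightarrow> 'v) \<Rightarrow>
     ('a \<Rightarrow> 'v \<Rightarrow> 'v) \<Rightarrow> ('v \<Rightarrow> 'a \<Rightarrow> 'v) \<Rightarrow> nat \<Rightarrow> ('a list \<Rightarrow> 'v) \<Rightarrow> 'a list \<Rightarrow> 'v" where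
  "hochschild_lam scaleA lam dA scaleV lact ract =
     hochschild scaleV (lact_lam scaleA lam dA lact) (ract_lam scaleA lam dA ract)"

text \<open>
  The index tuples $i_1 < \dots < i_k$ are the \<open>k\<close>-element sets \<open>I\<close> of positions.  For \<open>n = 0\<close> the
  outer sum is empty, which leaves $\delta v = - d_V(v)$.
\<close>

definition delta ::
    "'k::field \<Rightarrow> ('a \<Rightarrow> 'a) \<Rightarrow> ('k \<Rightarrow> 'v::ab_group_add \<Rightarrow> 'v) \<Rightarrow> ('v \<Rightarrow> 'v) \<Rightarrow>
     nat \<Rightarrow> ('a list \<Rightarrow> 'v) \<Rightarrow> 'a list \<Rightarrow> 'v" where
  "delta lam dA scaleV dV n f xs =
     (if length xs = n then
        (\<Sum>k = 1..n. scaleV (lam ^ (k - 1))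
           (\<Sum>I | I \<subseteq> {..<n} \<and> card I = k.
              f (map (\<lambda>i. if i \<in> I then dA (xs ! i) else xs ! i) [0..<n])))
        - dV (f xs)
      else 0)"

text \<open>
  So that all degrees live in one type, an element $v$ of degree 0 is represented by the pair
  \<open>(v, 0)\<close>.
\<close>

fun cochains_DA ::
    "('k::field \<Rightarrow> 'a::ab_group_add \<Rightarrow> 'a) \<Rightarrow> ('k \<Rightarrow> 'v::ab_group_add \<Rightarrow> 'v) \<Rightarrow> nat \<Rightarrow>
     (('a list \<Rightarrow> 'v) \<times> ('a list \<Rightarrow> 'v)) set" where
  "cochains_DA scaleA scaleV 0 = cochains scaleA scaleV 0 \<times> {0}"
| "cochains_DA scaleA scaleV (Suc n) = cochains scaleA scaleV (Suc n) \<times> cochains scaleA scaleV n"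

definition scale_fun :: "('k \<Rightarrow> 'v \<Rightarrow> 'v) \<Rightarrow> 'k \<Rightarrow> ('b \<Rightarrow> 'v) \<Rightarrow> 'b \<Rightarrow> 'v" where
  "scale_fun scaleV c f = (\<lambda>b. scaleV c (f b))"

definition scale_DA ::
    "('k \<Rightarrow> 'v \<Rightarrow> 'v) \<Rightarrow> 'k \<Rightarrow> ('b \<Rightarrow> 'v) \<times> ('b \<Rightarrow> 'v) \<Rightarrow> ('b \<Rightarrow> 'v) \<times> ('b \<Rightarrow> 'v)" where
  "scale_DA scaleV c = map_prod (scale_fun scaleV c) (scale_fun scaleV c)"

fun diff_DA ::
    "('k::field \<Rightarrow> 'a::ring \<Rightarrow> 'a) \<Rightarrow> 'k \<Rightarrow> ('a \<Rightarrow> 'a) \<Rightarrow> ('k \<Rightarrow> 'v::ab_group_add \<Rightarrow> 'v) \<Rightarrow>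
     ('a \<Rightarrow> 'v \<Rightarrow> 'v) \<Rightarrow> ('v \<Rightarrow> 'a \<Rightarrow> 'v) \<Rightarrow> ('v \<Rightarrow> 'v) \<Rightarrow>
     nat \<Rightarrow> ('a list \<Rightarrow> 'v) \<times> ('a list \<Rightarrow> 'v) \<Rightarrow> ('a list \<Rightarrow> 'v) \<times> ('a list \<Rightarrow> 'v)" where
  "diff_DA scaleA lam dA scaleV lact ract dV 0 (v, g) =
     (hochschild scaleV lact ract 0 v, delta lam dA scaleV dV 0 v)"
| "diff_DA scaleA lam dA scaleV lact ract dV (Suc n) (f, g) =
     (hochschild scaleV lact ract (Suc n) f,
      hochschild_lam scaleA lam dA scaleV lact ract n g
      + scale_fun scaleV ((- 1) ^ Suc n) (delta lam dA scaleV dV (Suc n) f))"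

text \<open>
  A cochain complex of vector spaces, the space in degree \<open>n\<close> being a subspace \<open>C n\<close> of an ambient
  vector space with scalar multiplication \<open>s\<close>.  The differentials \<open>d n\<close> are only relevant on \<open>C n\<close>.
\<close>

definition cochain_complex ::
    "('k::field \<Rightarrow> 'c::ab_group_add \<Rightarrow> 'c) \<Rightarrow> (nat \<Rightarrow> 'c set) \<Rightarrow> (nat \<Rightarrow> 'c \<Rightarrow> 'c) \<Rightarrow> bool" where
  "cochain_complex s C d \<longleftrightarrow>
     vector_space s \<and>
     (\<forall>n. module.subspace s (C n)) \<and>
     (\<forall>n. d n ` C n \<subseteq> C (Suc n)) \<and>
     (\<forall>n. \<forall>x\<in>C n. \<forall>y\<in>C n. d n (x + y) = d n x + d n y) \<and>
     (\<forall>n c. \<forall>x\<in>C n. d n (s c x) = s c (d n x)) \<and>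
     (\<forall>n. \<forall>x\<in>C n. d (Suc n) (d n x) = 0)"

end

theory Submission
  imports Defs
begin

text \<open>
  Everything reduces to $\delta \partial = \partial_\lambda \delta$ together with
  $\partial^2 = 0$ and $\partial_\lambda^2 = 0$; both squares are the same statement, applied to
  the two bimodule structures.  Since $\varphi = \mathrm{id} + \lambda d_A$ is an algebra endomorphism
  and $d_A(xy) = d_A(x) y + \varphi(x) d_A(y)$, multilinearity turns the sum over subsets in
  $\delta$ into the telescoping form
  $\sum_i f(\varphi(x_1), \dots, \varphi(x_{i-1}), d_A(x_i), x_{i+1}, \dots, x_n)$, which has no
  powers of $\lambda$ and is therefore insensitive to whether $\lambda$ vanishes.  In this form
  $\delta$ intertwines each single coface map of $\partial$ with that of $\partial_\lambda$.
\<close>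

section \<open>Twisted derivations on lists\<close>

text \<open>The telescoping sum. The treated head is absorbed into \<open>f\<close> instead of being
  tracked by an index, so inductions over the list generalise over \<open>f\<close>.\<close>

fun twist_sum :: "('a \<Rightarrow> 'a) \<Rightarrow> ('a \<Rightarrow> 'a) \<Rightarrow> ('a list \<Rightarrow> 'v::comm_monoid_add) \<Rightarrow> 'a list \<Rightarrow> 'v" where
  "twist_sum p d f [] = 0"
| "twist_sum p d f (x # xs) = f (d x # xs) + twist_sum p d (\<lambda>ys. f (p x # ys)) xs"

text \<open>Only lists of the length of \<open>xs\<close> are ever fed to \<open>f\<close>. This
  permits rewriting under \<open>twist_sum\<close> with identities that hold in one length only,
  such as the expansion of \<open>hochschild\<close>.\<close>

lemma twist_sum_cong:
  assumes "\<And>ys. length ys = length xs \<Longrightarrow> f ys = g ys"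
  shows "twist_sum p d f xs = twist_sum p d g xs"
  using assms
proof (induction xs arbitrary: f g)
  case (Cons x xs)
  have "twist_sum p d (\<lambda>ys. f (p x # ys)) xs = twist_sum p d (\<lambda>ys. g (p x # ys)) xs"
    by (rule Cons.IH) (simp add: Cons.prems)
  then show ?case by (simp add: Cons.prems)
qed simp

text \<open>The recursion read from the right end, as the last coface requires.\<close>

lemma twist_sum_snoc:
  "twist_sum p d f (xs @ [x]) = twist_sum p d (\<lambda>ys. f (ys @ [x])) xs + f (map p xs @ [d x])"
  by (induction xs arbitrary: f) (auto simp: add.assoc)

lemma twist_sum_hom:
  assumes "L 0 = 0" "\<And>u v. L (u + v) = L u + L v"
  shows "twist_sum p d (\<lambda>ys. L (f ys)) xs = L (twist_sum p d f xs)"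
  by (induction xs arbitrary: f) (auto simp: assms)

lemma twist_sum_sum:
  "twist_sum p d (\<lambda>ys. \<Sum>i\<in>A. g i ys) xs = (\<Sum>i\<in>A. twist_sum p d (g i) xs)"
  by (induction xs arbitrary: g) (auto simp: sum.distrib)

section \<open>Sums over nonempty sets of positions\<close>

definition apply_on :: "nat set \<Rightarrow> ('a \<Rightarrow> 'a) \<Rightarrow> 'a list \<Rightarrow> 'a list" where
  "apply_on I d xs = map (\<lambda>i. if i \<in> I then d (xs ! i) else xs ! i) [0..<length xs]"

lemma length_apply_on [simp]: "length (apply_on I d xs) = length xs"
  by (simp add: apply_on_def)

lemma apply_on_empty [simp]: "apply_on {} d xs = xs"
  by (simp add: apply_on_def map_nth)

text \<open>Prepares the split of the index sets by whether they contain position 0.\<close>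

lemma apply_on_Cons:
  "apply_on (Suc ` I) d (x # xs) = x # apply_on I d xs"
  "apply_on (insert 0 (Suc ` I)) d (x # xs) = d x # apply_on I d xs"
  by (auto simp: apply_on_def upt_conv_Cons map_Suc_upt[symmetric] simp del: upt_Suc)

lemma apply_on_update:
  assumes "i < length xs"
  shows "apply_on I d (xs[i := x]) = (apply_on I d xs)[i := if i \<in> I then d x else x]"
  by (rule nth_equalityI) (use assms in \<open>auto simp: apply_on_def nth_list_update\<close>)

text \<open>In the second family \<open>I\<close> may be empty, since inserting 0 already makes the
  set nonempty.\<close>

lemma nonempty_subsets_lessThan_Suc:
  "Pow {..<Suc n} - {{}} =
     (\<lambda>I. Suc ` I) ` (Pow {..<n} - {{}}) \<union> (\<lambda>I. insert 0 (Suc ` I)) ` Pow {..<n}"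
proof -
  have "Pow (Suc ` {..<n}) = (\<lambda>I. Suc ` I) ` Pow {..<n}"
    by (rule image_Pow_surj[symmetric]) simp
  then show ?thesis
    by (auto simp: lessThan_Suc_eq_insert_0 Pow_insert image_image)
qed

lemma sum_nonempty_subsets_Suc:
  fixes g :: "nat set \<Rightarrow> 'v::comm_monoid_add"
  shows "(\<Sum>I\<in>Pow {..<Suc n} - {{}}. g I) =
    (\<Sum>I\<in>Pow {..<n} - {{}}. g (Suc ` I)) + (\<Sum>I\<in>Pow {..<n}. g (insert 0 (Suc ` I)))"
proof -
  have inj: "inj_on (\<lambda>I. Suc ` I) X" "inj_on (\<lambda>I. insert 0 (Suc ` I)) X" for X
    by (auto simp: inj_on_def inj_image_eq_iff insert_eq_iff dest!: insert_ident[THEN iffD1, rotated -1])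
  show ?thesis
    unfolding nonempty_subsets_lessThan_Suc
    by (subst sum.union_disjoint) (auto simp: sum.reindex inj)
qed

text \<open>Every nonempty set of positions has exactly one cardinality, lying in
  \<open>{1..n}\<close>; this removes the grading by \<open>k\<close> used in
  \<open>delta\<close>.\<close>

lemma sum_by_card:
  fixes g :: "nat set \<Rightarrow> 'v::comm_monoid_add"
  shows "(\<Sum>k = 1..n. \<Sum>I | I \<subseteq> {..<n} \<and> card I = k. g I) = (\<Sum>I\<in>Pow {..<n} - {{}}. g I)"
proof -
  have "card I \<in> {1..n}" if "I \<in> Pow {..<n} - {{}}" for I
    using that card_mono[of "{..<n}" I] finite_subset[of I "{..<n}"]
    by (auto simp: Suc_le_eq card_gt_0_iff)
  then have "card ` (Pow {..<n} - {{}}) \<subseteq> {1..n}" by blast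
  then have "(\<Sum>I\<in>Pow {..<n} - {{}}. g I) =
      (\<Sum>k = 1..n. \<Sum>I | I \<in> Pow {..<n} - {{}} \<and> card I = k. g I)"
    by (intro sum.group[symmetric]) simp_all
  also have "\<dots> = (\<Sum>k = 1..n. \<Sum>I | I \<subseteq> {..<n} \<and> card I = k. g I)"
    by (intro sum.cong refl) auto
  finally show ?thesis by simp
qed

section \<open>Multiplying neighbours in a list\<close>

text \<open>Recursive form of the product of neighbours in \<open>hochschild\<close>, suited to
  induction; lists that are too short are left unchanged.\<close>

fun merge :: "nat \<Rightarrow> 'a::times list \<Rightarrow> 'a list" where
  "merge 0 (x # y # zs) = x * y # zs"
| "merge (Suc i) (x # xs) = x # merge i xs"
| "merge _ xs = xs"

lemma merge_conv:
  "Suc i < length xs \<Longrightarrow> merge i xs = take i xs @ [xs ! i * xs ! (i + 1)] @ drop (i + 2) xs"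
  by (induction i xs rule: merge.induct) auto

lemma length_merge: "Suc i < length xs \<Longrightarrow> length (merge i xs) = length xs - 1"
  by (simp add: merge_conv)

text \<open>For multilinearity of the inner cofaces: one changed entry stays one changed entry, up
  to a multiplication at the merged pair and a shift by one behind it.\<close>

lemma merge_update:
  assumes "Suc i < length xs" "j < length xs"
  shows "merge i (xs[j := x]) =
    (if j < i then (merge i xs)[j := x]
     else if j = i then (merge i xs)[i := x * xs ! (i + 1)]
     else if j = Suc i then (merge i xs)[i := xs ! i * x]
     else (merge i xs)[j - 1 := x])"
  using assms
proof (induction i xs arbitrary: j rule: merge.induct)
  case (1 a b zs)
  then show ?case by (auto split: nat.splits simp: list_update.simps)
next
  case (2 i a xs)
  then show ?case by (cases j) (auto split: nat.splits)
qed auto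

text \<open>For \<open>i = j\<close> this is associativity on three consecutive entries; for
  \<open>i < j\<close> the pairs are disjoint and only the index shift remains.\<close>

lemma merge_merge:
  fixes xs :: "'a::semigroup_mult list"
  assumes "i \<le> j" "Suc (Suc j) < length xs"
  shows "merge i (merge (Suc j) xs) = merge j (merge i xs)"
  using assms
proof (induction i arbitrary: j xs)
  case 0
  then obtain x y z zs where "xs = x # y # z # zs"
    by (auto simp: Suc_less_eq2 length_Suc_conv numeral_eq_Suc)
       (metis Suc_length_conv less_nat_zero_code list.exhaust list.size(3) not_less_eq)
  then show ?case by (cases j) (auto simp: mult.assoc)
next
  case (Suc i)
  then obtain x ys where "xs = x # ys" by (cases xs) auto
  moreover obtain k where "j = Suc k" using Suc.prems by (cases j) auto
  ultimately show ?case using Suc by auto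
qed

lemma merge_snoc:
  "Suc i < length xs \<Longrightarrow> merge i (xs @ [z]) = merge i xs @ [z]"
  by (induction i xs rule: merge.induct) auto

lemma merge_last: "merge (length zs) (zs @ [x, y]) = zs @ [x * y]"
  by (induction zs) auto

section \<open>Cosimplicial structure\<close>

text \<open>The maps whose alternating sum is the Hochschild coboundary: index 0 is the left action,
  \<open>n + 1\<close> the right action. An index \<open>i\<close> in between multiplies at list
  position \<open>i - 1\<close>, as positions start at 0.\<close>

definition coface :: "('a::times \<Rightarrow> 'v \<Rightarrow> 'v) \<Rightarrow> ('v \<Rightarrow> 'a \<Rightarrow> 'v) \<Rightarrow> nat \<Rightarrow> nat \<Rightarrow>
    ('a list \<Rightarrow> 'v) \<Rightarrow> 'a list \<Rightarrow> 'v" where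
  "coface lact ract n i f xs =
     (if i = 0 then lact (hd xs) (f (tl xs))
      else if i \<le> n then f (merge (i - 1) xs)
      else ract (f (butlast xs)) (last xs))"

lemma coface_cong:
  assumes "\<And>ys. length ys = n \<Longrightarrow> f ys = g ys" "length xs = Suc n"
  shows "coface lact ract n i f xs = coface lact ract n i g xs"
  using assms by (auto simp: coface_def length_merge)

text \<open>Restricted to length \<open>Suc n\<close> because \<open>coface\<close>, unlike
  \<open>hochschild\<close>, is not cut off to 0 elsewhere.\<close>

lemma hochschild_eq_coface:
  assumes "length xs = Suc n" "vector_space scaleV"
  shows "hochschild scaleV lact ract n f xs =
    (\<Sum>i\<le>Suc n. scaleV ((- 1) ^ i) (coface lact ract n i f xs))"
proof -
  interpret vector_space scaleV by fact
  have "xs \<noteq> []" using assms by auto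
  moreover have "(\<Sum>i<n. scaleV ((- 1) ^ (i + 1)) (coface lact ract n (Suc i) f xs)) =
      (\<Sum>i<n. scaleV ((- 1) ^ (i + 1))
         (f (take i xs @ [xs ! i * xs ! (i + 1)] @ drop (i + 2) xs)))"
    by (intro sum.cong refl) (simp add: coface_def merge_conv assms)
  ultimately show ?thesis
    \<comment> \<open>\<open>sum.atMost_Suc\<close> detaches the right action and
      \<open>sum.atMost_shift\<close> the left one, leaving the inner cofaces.\<close>
    unfolding hochschild_def sum.atMost_Suc sum.atMost_shift
    using assms
    by (simp add: coface_def hd_conv_nth last_conv_nth butlast_conv_take drop_Suc)
qed

text \<open>The terms cancel in pairs: \<open>(j, i)\<close> with \<open>i < j\<close> is matched
  with \<open>(i, j - 1)\<close>, where \<open>G\<close> agrees and the exponent of the sign is one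
  less.\<close>

lemma cosimplicial_sum_zero:
  fixes G :: "nat \<Rightarrow> nat \<Rightarrow> 'v::ab_group_add"
  assumes "vector_space s" and G: "\<And>i j. i < j \<Longrightarrow> j \<le> Suc m \<Longrightarrow> G j i = G i (j - 1)"
  shows "(\<Sum>j\<le>Suc m. \<Sum>i\<le>m. s ((- 1) ^ j) (s ((- 1) ^ i) (G j i))) = 0"
proof -
  interpret vector_space s by fact
  define h where "h = (\<lambda>(j, i). s ((- 1) ^ (i + j)) (G j i))"
  define P where "P = {..Suc m} \<times> {..m}"
  have fin: "finite P" by (simp add: P_def)
  have "(\<Sum>j\<le>Suc m. \<Sum>i\<le>m. s ((- 1) ^ j) (s ((- 1) ^ i) (G j i))) = sum h P"
    by (simp add: h_def P_def sum.cartesian_product power_add mult.commute del: sum.atMost_Suc)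
  also have "\<dots> = sum h {x\<in>P. snd x < fst x} + sum h {x\<in>P. fst x \<le> snd x}"
    by (subst sum.union_disjoint[symmetric]) (auto intro!: sum.cong simp: fin)
  also have "sum h {x\<in>P. snd x < fst x} = sum (\<lambda>x. - h x) {x\<in>P. fst x \<le> snd x}"
  proof (rule sum.reindex_bij_witness[of _ "\<lambda>(j, i). (Suc i, j)" "\<lambda>(j, i). (i, j - 1)"])
    fix x assume x: "x \<in> {x\<in>P. snd x < fst x}"
    obtain j i where ji: "x = (Suc j, i)"
      using x by (cases x; cases "fst x") auto
    show "- h ((\<lambda>(j, i). (i, j - 1)) x) = h x"
      using x G[of i "Suc j"] by (auto simp: h_def ji P_def add.commute)
  qed (auto simp: P_def)
  finally show ?thesis by (simp add: sum_negf)
qed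

section \<open>Multilinear maps\<close>

text \<open>The linearity clause of \<open>cochains\<close> alone: a single coface inherits it, but
  need not vanish on lists of other lengths.\<close>

definition multilinear where
  "multilinear s1 s2 n f \<longleftrightarrow> (\<forall>xs i. length xs = n \<longrightarrow> i < n \<longrightarrow>
     Vector_Spaces.linear s1 s2 (\<lambda>x. f (xs[i := x])))"

lemma cochains_iff:
  "f \<in> cochains s1 s2 n \<longleftrightarrow> multilinear s1 s2 n f \<and> (\<forall>xs. length xs \<noteq> n \<longrightarrow> f xs = 0)"
  by (simp add: cochains_def multilinear_def)

lemma multilinear_Cons:
  fixes f :: "'a::ab_group_add list \<Rightarrow> 'v::ab_group_add"
  assumes "multilinear s1 s2 (Suc n) f"
  shows "multilinear s1 s2 n (\<lambda>ys. f (x # ys))"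
  unfolding multilinear_def
proof (intro allI impI)
  fix xs :: "'a list" and i assume "length xs = n" "i < n"
  then show "Vector_Spaces.linear s1 s2 (\<lambda>y. f (x # xs[i := y]))"
    using assms[unfolded multilinear_def, rule_format, of "x # xs" "Suc i"] by simp
qed

lemma multilinear_hd:
  assumes "multilinear s1 s2 (Suc n) f" "length xs = n"
  shows "f ((x + y) # xs) = f (x # xs) + f (y # xs)" "f (s1 c x # xs) = s2 c (f (x # xs))"
proof -
  \<comment> \<open>The entry \<open>undefined\<close> is a placeholder that the update at position
    0 overwrites.\<close>
  have "Vector_Spaces.linear s1 s2 (\<lambda>x. f (x # xs))"
    using assms(1)[unfolded multilinear_def, rule_format, of "undefined # xs" 0] assms(2) by simp
  then interpret Vector_Spaces.linear s1 s2 "\<lambda>x. f (x # xs)" .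
  show "f ((x + y) # xs) = f (x # xs) + f (y # xs)" "f (s1 c x # xs) = s2 c (f (x # xs))"
    by (rule add, rule scale)
qed


lemma linear_comp:
  "Vector_Spaces.linear s1 s2 f \<Longrightarrow> Vector_Spaces.linear s2 s3 g \<Longrightarrow>
    Vector_Spaces.linear s1 s3 (\<lambda>x. g (f x))"
  using Vector_Spaces.linear_compose[of s1 s2 f s3 g] by (simp add: o_def)

lemma multilinear_update:
  assumes "multilinear s1 s2 n f" "length xs = n" "i < n" "Vector_Spaces.linear s0 s1 h"
  shows "Vector_Spaces.linear s0 s2 (\<lambda>x. f (xs[i := h x]))"
  using linear_comp[OF assms(4), of s2 "\<lambda>x. f (xs[i := x])"] assms(1-3)
  by (simp add: multilinear_def)

section \<open>The Hochschild complex\<close>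

context assoc_bimodule
begin

interpretation AV: vector_space_pair scaleA scaleV ..
interpretation VV: vector_space_pair scaleV scaleV ..

lemma act_simps:
  "lact (x + y) v = lact x v + lact y v" "lact (scaleA c x) v = scaleV c (lact x v)"
  "lact x (v + w) = lact x v + lact x w" "lact x (scaleV c v) = scaleV c (lact x v)"
  "lact x 0 = 0" "lact x (v - w) = lact x v - lact x w"
  "ract v (x + y) = ract v x + ract v y" "ract v (scaleA c x) = scaleV c (ract v x)"
  "ract (v + w) x = ract v x + ract w x" "ract (scaleV c v) x = scaleV c (ract v x)"
  "ract 0 x = 0" "ract (v - w) x = ract v x - ract w x"
  using lact_linear_left[of v] lact_linear_right[of x] ract_linear_left[of x] ract_linear_right[of v]
    VV.linear_0[OF lact_linear_right] VV.linear_diff[OF lact_linear_right]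
    VV.linear_0[OF ract_linear_left] VV.linear_diff[OF ract_linear_left]
  by (auto simp: Vector_Spaces.linear_iff)

abbreviation "cf \<equiv> coface lact ract"

lemma coface_add: "cf n i (\<lambda>xs. f xs + g xs) xs = cf n i f xs + cf n i g xs"
  by (simp add: coface_def act_simps)

lemma coface_scale: "cf n i (\<lambda>xs. scaleV c (f xs)) xs = scaleV c (cf n i f xs)"
  by (simp add: coface_def act_simps)

lemma coface_zero: "cf n i (\<lambda>xs. 0) xs = 0"
  by (simp add: coface_def act_simps)

lemma coface_sum: "cf n i (\<lambda>xs. \<Sum>j\<in>J. g j xs) xs = (\<Sum>j\<in>J. cf n i (g j) xs)"
  by (induction J rule: infinite_finite_induct) (simp_all add: coface_zero coface_add)

text \<open>The cosimplicial identities, through which the bimodule laws enter the square of the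
  coboundary.\<close>

lemma coface_coface:
  assumes "i < j" "j \<le> Suc (Suc n)" "length xs = Suc (Suc n)"
  shows "cf (Suc n) j (cf n i f) xs = cf (Suc n) i (cf n (j - 1) f) xs"
proof -
  obtain x xs' where xs': "xs = x # xs'" "xs' \<noteq> []"
    using assms(3) by (auto simp: length_Suc_conv)
  obtain zs y where snoc: "xs' = zs @ [y]"
    using xs'(2) by (meson rev_exhaust)
  \<comment> \<open>In order: associativity of the left action, left action against an inner merge,
    compatibility of the two actions, two inner merges, inner merge against the right action,
    associativity of the right action.\<close>
  consider "i = 0" "j = 1" | k where "i = 0" "j = Suc (Suc k)" "j \<le> Suc n"
    | "i = 0" "j = Suc (Suc n)"
    | i' k where "i = Suc i'" "j = Suc (Suc k)" "i' \<le> k" "k < n"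
    | i' where "i = Suc i'" "i' < n" "j = Suc (Suc n)"
    | "i = Suc n" "j = Suc (Suc n)"
  proof (cases i)
    case 0 then show ?thesis using that(1-3) assms(1,2) by (cases j; cases "j - 1") force+
  next
    case (Suc i')
    then show ?thesis using that(4)[of i' "j - 2"] that(5,6) assms(1,2) by force
  qed
  then show ?thesis
  proof cases
    case 1
    obtain y' ys where "xs' = y' # ys" using xs' by (cases xs') auto
    then show ?thesis using 1 by (simp add: coface_def xs' lact_mult)
  next
    case 2
    then show ?thesis by (simp add: coface_def xs')
  next
    case 3
    then show ?thesis by (simp add: coface_def xs' snoc lact_ract)
  next
    case 4
    then show ?thesis using assms(3) by (simp add: coface_def merge_merge)
  next
    case 5
    then have "merge i' xs = merge i' (x # zs) @ [y]"
      using assms(3) merge_snoc[of i' "x # zs" y] by (simp add: xs' snoc)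
    then show ?thesis using 5 by (simp add: coface_def xs' snoc)
  next
    case 6
    obtain ws z where ws: "x # zs = ws @ [z]" by (metis list.distinct(1) rev_exhaust)
    have eq: "xs = ws @ [z, y]" using ws by (simp add: xs' snoc)
    then have "merge n xs = ws @ [z * y]"
      using merge_last[of ws z y] assms(3) by simp
    then show ?thesis using 6 by (simp add: coface_def eq ract_mult butlast_append)
  qed
qed

lemma hochschild_hochschild:
  "hochschild scaleV lact ract (Suc n) (hochschild scaleV lact ract n f) = 0"
proof
  fix xs
  show "hochschild scaleV lact ract (Suc n) (hochschild scaleV lact ract n f) xs = 0 xs"
  proof (cases "length xs = Suc (Suc n)")
    case True
    have "cf (Suc n) j (hochschild scaleV lact ract n f) xs =
        (\<Sum>i\<le>Suc n. scaleV ((- 1) ^ i) (cf (Suc n) j (cf n i f) xs))" for j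
    proof -
      \<comment> \<open>The expansion holds only in length \<open>Suc n\<close>, which is where this
        coface evaluates its argument.\<close>
      have "cf (Suc n) j (hochschild scaleV lact ract n f) xs =
          cf (Suc n) j (\<lambda>xs. \<Sum>i\<le>Suc n. scaleV ((- 1) ^ i) (cf n i f xs)) xs"
        by (rule coface_cong) (simp_all only: hochschild_eq_coface[OF _ V.vector_space_axioms] True)
      then show ?thesis by (simp only: coface_sum coface_scale)
    qed
    then have "hochschild scaleV lact ract (Suc n) (hochschild scaleV lact ract n f) xs =
        (\<Sum>j\<le>Suc (Suc n). \<Sum>i\<le>Suc n.
           scaleV ((- 1) ^ j) (scaleV ((- 1) ^ i) (cf (Suc n) j (cf n i f) xs)))"
      by (simp only: hochschild_eq_coface[OF True V.vector_space_axioms] V.scale_sum_right)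
    also have "\<dots> = 0"
      by (rule cosimplicial_sum_zero[OF V.vector_space_axioms]) (use coface_coface True in blast)
    finally show ?thesis by simp
  qed (simp add: hochschild_def)
qed

lemma multilinear_coface:
  assumes f: "multilinear scaleA scaleV n f" and "i \<le> Suc n"
  shows "multilinear scaleA scaleV (Suc n) (cf n i f)"
  unfolding multilinear_def
proof (intro allI impI)
  fix xs :: "'a list" and j assume xs: "length xs = Suc n" and j: "j < Suc n"
  have id: "Vector_Spaces.linear scaleA scaleA (\<lambda>x. x)" by (rule A.linear_ident)
  have mult: "Vector_Spaces.linear scaleA scaleA (\<lambda>x. x * y)"
    "Vector_Spaces.linear scaleA scaleA (\<lambda>x. y * x)" for y
    by (simp_all add: Vector_Spaces.linear_iff A.vector_space_axioms scale_mult_left scale_mult_right algebra_simps)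
  consider "i = 0" | i' where "i = Suc i'" "i' < n" | "i = Suc n"
    using assms(2) by (cases i) force+
  then show "Vector_Spaces.linear scaleA scaleV (\<lambda>x. cf n i f (xs[j := x]))"
  proof cases
    case 1
    obtain y ys where ys: "xs = y # ys" using xs by (cases xs) auto
    show ?thesis
    proof (cases j)
      case 0
      then show ?thesis by (simp add: coface_def 1 ys lact_linear_left)
    next
      case (Suc k)
      then have "Vector_Spaces.linear scaleA scaleV (\<lambda>x. f (ys[k := x]))"
        using j xs ys by (intro multilinear_update[OF f _ _ id]) auto
      from linear_comp[OF this lact_linear_right[of y]] show ?thesis
        by (simp add: coface_def 1 ys Suc)
    qed
  next
    case 2
    have len: "length (merge i' xs) = n" using 2 xs by (simp add: length_merge)
    \<comment> \<open>Left of the merged pair, its two factors, right of it; \<open>mult\<close>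
      handles the factors.\<close>
    consider "j < i'" | "j = i'" | "j = Suc i'" | "Suc i' < j" by linarith
    then show ?thesis
      by cases
         (use 2 xs j in \<open>simp_all add: coface_def merge_update len multilinear_update[OF f] id mult\<close>)
  next
    case 3
    obtain zs y where zs: "xs = zs @ [y]" using xs by (cases xs rule: rev_cases) auto
    show ?thesis
    proof (cases "j = n")
      case True
      then have "length zs = j" using xs zs by simp
      then show ?thesis using 3 by (auto simp: coface_def zs ract_linear_right)
    next
      case False
      then have jn: "j < length zs" using j xs zs by simp
      then have "Vector_Spaces.linear scaleA scaleV (\<lambda>x. f (zs[j := x]))"
        using xs zs by (intro multilinear_update[OF f _ _ id]) auto
      from linear_comp[OF this ract_linear_left[of y]] show ?thesis
        using jn by (simp add: coface_def 3 zs list_update_append)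
    qed
  qed
qed

lemma hochschild_in_cochains:
  assumes "multilinear scaleA scaleV n f"
  shows "hochschild scaleV lact ract n f \<in> cochains scaleA scaleV (Suc n)"
  unfolding cochains_iff
proof
  have "Vector_Spaces.linear scaleA scaleV
      (\<lambda>x. \<Sum>i\<le>Suc n. scaleV ((- 1) ^ i) (cf n i f (xs[j := x])))"
    if "length xs = Suc n" "j < Suc n" for xs j
    using multilinear_coface[OF assms] that
    by (intro AV.linear_compose_sum ballI AV.linear_compose_scale_right) (auto simp: multilinear_def)
  then show "multilinear scaleA scaleV (Suc n) (hochschild scaleV lact ract n f)"
    unfolding multilinear_def
    by (simp add: hochschild_eq_coface[OF _ V.vector_space_axioms] del: sum.atMost_Suc)
qed (simp add: hochschild_def)

lemma hochschild_add:
  "hochschild scaleV lact ract n (f + g) = hochschild scaleV lact ract n f + hochschild scaleV lact ract n g"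
proof
  fix xs
  show "hochschild scaleV lact ract n (f + g) xs =
      (hochschild scaleV lact ract n f + hochschild scaleV lact ract n g) xs"
  proof (cases "length xs = Suc n")
    case True
    then show ?thesis
      by (simp add: hochschild_eq_coface[OF _ V.vector_space_axioms] plus_fun_def coface_add
          V.scale_right_distrib sum.distrib del: sum.atMost_Suc)
  qed (simp add: hochschild_def)
qed

lemma hochschild_scale:
  "hochschild scaleV lact ract n (scale_fun scaleV c f) = scale_fun scaleV c (hochschild scaleV lact ract n f)"
proof
  fix xs
  show "hochschild scaleV lact ract n (scale_fun scaleV c f) xs =
      scale_fun scaleV c (hochschild scaleV lact ract n f) xs"
  proof (cases "length xs = Suc n")
    case True
    then show ?thesis
      by (simp add: hochschild_eq_coface[OF _ V.vector_space_axioms] scale_fun_def coface_scale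
          V.scale_sum_right mult.commute del: sum.atMost_Suc)
  qed (simp add: hochschild_def scale_fun_def)
qed

end

section \<open>Compatibility of $\delta$ with the coboundaries\<close>

context differential_bimodule
begin

interpretation AV: vector_space_pair scaleA scaleV ..
interpretation VV: vector_space_pair scaleV scaleV ..

section \<open>The twist \<open>phi\<close> and the bimodule structure it induces\<close>

definition "phi x = x + scaleA lam (dA x)"

lemma dA_simps: "dA (x + y) = dA x + dA y" "dA (scaleA c x) = scaleA c (dA x)"
  using linear_dA by (auto simp: Vector_Spaces.linear_iff)

lemma dV_simps: "dV (x + y) = dV x + dV y" "dV (scaleV c x) = scaleV c (dV x)"
    "dV 0 = 0" "dV (x - y) = dV x - dV y" "dV (sum g S) = (\<Sum>i\<in>S. dV (g i))"
  using linear_dV by (auto simp: Vector_Spaces.linear_iff VV.linear_0 VV.linear_diff VV.linear_sum)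

text \<open>Expanding the right-hand side, everything beyond \<open>x * y\<close> is
  \<open>lam\<close> times the weighted Leibniz expansion of \<open>dA (x * y)\<close>.\<close>

lemma phi_mult: "phi (x * y) = phi x * phi y"
  by (simp add: phi_def dA_mult scale_mult_left scale_mult_right A.scale_right_distrib algebra_simps)

lemma phi_linear: "Vector_Spaces.linear scaleA scaleA phi"
  by (simp add: Vector_Spaces.linear_iff A.vector_space_axioms phi_def dA_simps A.scale_right_distrib mult.commute)

lemma phi_dA_mult: "dA (x * y) = dA x * y + phi x * dA y"
  by (simp add: phi_def dA_mult scale_mult_left algebra_simps)

text \<open>The twisted actions are the given ones pulled back along the algebra endomorphism
  \<open>phi\<close>, which preserves every bimodule law.\<close>

lemma bimodule_lam:
  "assoc_bimodule scaleA scaleV (lact_lam scaleA lam dA lact) (ract_lam scaleA lam dA ract)"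
proof -
  have eq: "lact_lam scaleA lam dA lact x v = lact (phi x) v"
    "ract_lam scaleA lam dA ract v x = ract v (phi x)" for x v
    by (simp_all add: lact_lam_def ract_lam_def phi_def)
  show ?thesis
    by (intro assoc_bimodule.intro assoc_bimodule_axioms.intro assoc_algebra_axioms V.vector_space_axioms)
       (simp_all only: eq phi_mult lact_mult ract_mult lact_ract lact_linear_right ract_linear_left
         linear_comp[OF phi_linear lact_linear_left] linear_comp[OF phi_linear ract_linear_right])
qed

section \<open>The telescoping operator \<open>D\<close> and the cofaces\<close>

abbreviation "D \<equiv> twist_sum phi dA"

lemma phi_Cons:
  assumes "multilinear scaleA scaleV (Suc n) f" "length xs = n"
  shows "f (phi x # xs) = f (x # xs) + scaleV lam (f (dA x # xs))"
  using assms by (simp add: phi_def multilinear_hd)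

text \<open>Peel off the first entry \<open>x\<close>: for nonempty \<open>I\<close>, the index sets
  with and without position 0 add up, by multilinearity, to one term with \<open>phi x\<close>. The
  factor \<open>lam\<close> inside \<open>phi\<close> matches the larger cardinality.\<close>

lemma D_subsets:
  assumes "multilinear scaleA scaleV n f" "length xs = n"
  shows "(\<Sum>I\<in>Pow {..<n} - {{}}. scaleV (lam ^ (card I - 1)) (f (apply_on I dA xs))) = D f xs"
  using assms
proof (induction n arbitrary: f xs)
  case (Suc n)
  obtain x ys where xs: "xs = x # ys" and len: "length ys = n"
    using Suc.prems(2) by (cases xs) auto
  let ?N = "Pow {..<n} - {{}}"
  have fin: "finite I" if "I \<in> Pow {..<n}" for I using that finite_subset by auto
  have card: "card (Suc ` I) = card I" for I by (simp add: card_image)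
  have card_ins: "card (insert 0 (Suc ` I)) = Suc (card I)" if "I \<in> Pow {..<n}" for I
    using fin[OF that] by (simp add: card)
  \<comment> \<open>Here \<open>I = {}\<close> stands for the index set consisting of position 0
    alone; it yields the first summand of \<open>D\<close>.\<close>
  have "(\<Sum>I\<in>Pow {..<n}. scaleV (lam ^ card I) (f (dA x # apply_on I dA ys))) =
      f (dA x # ys) + (\<Sum>I\<in>?N. scaleV (lam ^ card I) (f (dA x # apply_on I dA ys)))"
    by (subst sum.remove[of _ "{}"]) auto
  moreover have "scaleV (lam ^ (card I - 1)) (f (phi x # apply_on I dA ys)) =
      scaleV (lam ^ (card I - 1)) (f (x # apply_on I dA ys)) +
      scaleV (lam ^ card I) (f (dA x # apply_on I dA ys))" if "I \<in> ?N" for I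
  proof -
    \<comment> \<open>\<open>card I - 1\<close> is truncated subtraction; \<open>I\<close> is
      nonempty and finite, so nothing is cut off.\<close>
    have "lam ^ card I = lam ^ (card I - 1) * lam"
      using that fin[of I] by (cases "card I") auto
    then show ?thesis
      using phi_Cons[OF Suc.prems(1)] len by (simp add: V.scale_right_distrib)
  qed
  ultimately have "(\<Sum>I\<in>Pow {..<Suc n} - {{}}. scaleV (lam ^ (card I - 1)) (f (apply_on I dA xs))) =
      f (dA x # ys) + (\<Sum>I\<in>?N. scaleV (lam ^ (card I - 1)) (f (phi x # apply_on I dA ys)))"
    by (simp add: sum_nonempty_subsets_Suc xs apply_on_Cons card card_ins sum.distrib del: Pow_iff)
  also have "\<dots> = D f xs"
    using Suc.IH[OF multilinear_Cons[OF Suc.prems(1)] len] by (simp add: xs)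
  finally show ?case .
qed simp

text \<open>
  Needed for the last coface: there the derivation leaves $f(\varphi(x_1), \dots, \varphi(x_n))\, d_A(x_{n+1})$,
  whereas $\dashv_\lambda$ calls for unmodified arguments of $f$.
\<close>

lemma D_scale:
  assumes "multilinear scaleA scaleV n f" "length xs = n"
  shows "scaleV lam (D f xs) = f (map phi xs) - f xs"
  using assms
proof (induction n arbitrary: f xs)
  case (Suc n)
  obtain x ys where xs: "xs = x # ys" and len: "length ys = n"
    using Suc.prems(2) by (cases xs) auto
  show ?case
    using Suc.IH[OF multilinear_Cons[OF Suc.prems(1)] len] phi_Cons[OF Suc.prems(1) len]
    by (simp add: xs V.scale_right_distrib)
qed simp

text \<open>If the derivation hits the merged entry, \<open>phi_dA_mult\<close> yields the two terms
  in which it hits either factor; if it hits a later entry, the merged one carries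
  \<open>phi\<close> and \<open>phi_mult\<close> applies.\<close>

lemma D_merge:
  assumes "multilinear scaleA scaleV n f" "length xs = Suc n" "i < n"
  shows "D (\<lambda>ys. f (merge i ys)) xs = D f (merge i xs)"
  using assms
proof (induction i arbitrary: n f xs)
  case 0
  then obtain x y zs where xs: "xs = x # y # zs"
    by (cases xs; cases "tl xs") auto
  obtain m where m: "n = Suc m" "length zs = m" using 0 xs by (cases n) auto
  show ?case
    using multilinear_hd(1)[of scaleA scaleV m f] 0 m by (simp add: xs phi_mult phi_dA_mult add.assoc)
next
  case (Suc i)
  obtain x ys where xs: "xs = x # ys" using Suc.prems by (cases xs) auto
  obtain m where m: "n = Suc m" using Suc.prems by (cases n) auto
  show ?case
    using Suc.IH[OF multilinear_Cons[OF Suc.prems(1)[unfolded m]], of ys] Suc.prems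
    by (simp add: xs m)
qed

lemma D_coface:
  assumes f: "multilinear scaleA scaleV n f" and xs: "length xs = Suc n" and "i \<le> Suc n"
  shows "D (coface lact ract n i f) xs - dV (coface lact ract n i f xs) =
    coface (lact_lam scaleA lam dA lact) (ract_lam scaleA lam dA ract) n i (\<lambda>ys. D f ys - dV (f ys)) xs"
proof -
  consider "i = 0" | k where "i = Suc k" "k < n" | "i = Suc n"
    using assms(3) by (cases i) force+
  then show ?thesis
  proof cases
    case 1
    obtain x ys where "xs = x # ys" using xs by (cases xs) auto
    moreover have "D (\<lambda>ys. lact (phi x) (f ys)) ys = lact (phi x) (D f ys)"
      by (rule twist_sum_hom) (simp_all add: act_simps)
    \<comment> \<open>The terms with \<open>dA x\<close> acting on \<open>f ys\<close> cancel; the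
      weight term of \<open>dV_lact\<close> makes the remaining left action one by
      \<open>phi x\<close>.\<close>
    ultimately show ?thesis
      by (simp add: 1 coface_def lact_lam_def dV_lact) (simp add: phi_def act_simps)
  next
    case 2
    then have "coface lact' ract' n i g = (\<lambda>ys. g (merge k ys))"
      for lact' :: "'a \<Rightarrow> 'v \<Rightarrow> 'v" and ract' g
      by (simp add: coface_def fun_eq_iff)
    then show ?thesis using D_merge[OF f xs, of k] 2 by simp
  next
    case 3
    obtain ys x where ys: "xs = ys @ [x]" using xs by (cases xs rule: rev_cases) auto
    \<comment> \<open>Acted on by \<open>dA x\<close>, the surplus over \<open>f ys\<close> supplies
      the weight part of the right action of \<open>phi x\<close> on \<open>D f ys\<close>.\<close>
    have "f (map phi ys) = f ys + scaleV lam (D f ys)"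
      using D_scale[OF f] xs ys by simp
    then show ?thesis
      by (simp add: 3 ys coface_def ract_lam_def dV_ract act_simps twist_sum_snoc V.scale_right_diff_distrib
          twist_sum_hom[where L = "\<lambda>v. ract v z" for z])
  qed
qed

section \<open>Transfer from \<open>D\<close> to \<open>delta\<close>\<close>

lemma delta_eq:
  assumes "multilinear scaleA scaleV n f" "length xs = n"
  shows "delta lam dA scaleV dV n f xs = D f xs - dV (f xs)"
proof -
  \<comment> \<open>Writing the power of \<open>lam\<close> in terms of \<open>card I\<close> frees
    the summand from \<open>k\<close>, so that \<open>sum_by_card\<close> applies.\<close>
  have "(\<Sum>k = 1..n. scaleV (lam ^ (k - 1)) (\<Sum>I | I \<subseteq> {..<n} \<and> card I = k. f (apply_on I dA xs))) =
      (\<Sum>k = 1..n. \<Sum>I | I \<subseteq> {..<n} \<and> card I = k. scaleV (lam ^ (card I - 1)) (f (apply_on I dA xs)))"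
    by (simp add: V.scale_sum_right)
  also have "\<dots> = D f xs"
    by (simp only: sum_by_card D_subsets[OF assms])
  finally show ?thesis
    using assms(2) by (simp add: delta_def apply_on_def)
qed

text \<open>This is \<open>D_coface\<close> summed with alternating signs; it makes the mixed terms
  in the square of the total differential cancel.\<close>

lemma delta_hochschild:
  assumes f: "multilinear scaleA scaleV n f"
  shows "delta lam dA scaleV dV (Suc n) (hochschild scaleV lact ract n f) =
    hochschild_lam scaleA lam dA scaleV lact ract n (delta lam dA scaleV dV n f)"
proof
  fix xs
  let ?h = "hochschild scaleV lact ract n f"
  let ?cl = "coface (lact_lam scaleA lam dA lact) (ract_lam scaleA lam dA ract) n"
  show "delta lam dA scaleV dV (Suc n) ?h xs =
    hochschild_lam scaleA lam dA scaleV lact ract n (delta lam dA scaleV dV n f) xs"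
  proof (cases "length xs = Suc n")
    case True
    note hoch = hochschild_eq_coface[OF _ V.vector_space_axioms]
    have "multilinear scaleA scaleV (Suc n) ?h"
      using hochschild_in_cochains[OF f] by (simp add: cochains_iff)
    then have "delta lam dA scaleV dV (Suc n) ?h xs = D ?h xs - dV (?h xs)"
      using True by (rule delta_eq)
    also have "D ?h xs = D (\<lambda>xs. \<Sum>i\<le>Suc n. scaleV ((- 1) ^ i) (coface lact ract n i f xs)) xs"
      by (rule twist_sum_cong) (simp only: hoch True)
    also have "\<dots> = (\<Sum>i\<le>Suc n. scaleV ((- 1) ^ i) (D (coface lact ract n i f) xs))"
      by (simp only: twist_sum_sum twist_sum_hom[where L = "scaleV c" for c]
          V.scale_zero_right V.scale_right_distrib)
    also have "dV (?h xs) = (\<Sum>i\<le>Suc n. scaleV ((- 1) ^ i) (dV (coface lact ract n i f xs)))"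
      by (simp only: hoch True dV_simps)
    also have "(\<Sum>i\<le>Suc n. scaleV ((- 1) ^ i) (D (coface lact ract n i f) xs)) - \<dots> =
        (\<Sum>i\<le>Suc n. scaleV ((- 1) ^ i) (?cl i (\<lambda>ys. D f ys - dV (f ys)) xs))"
      unfolding sum_subtractf[symmetric] V.scale_right_diff_distrib[symmetric]
      by (intro sum.cong refl arg_cong[where f = "scaleV c" for c] D_coface f True) simp
    \<comment> \<open>\<open>delta_eq\<close> is available only in length \<open>n\<close>, which is
      all that \<open>coface_cong\<close> asks for.\<close>
    also have "\<dots> = (\<Sum>i\<le>Suc n. scaleV ((- 1) ^ i) (?cl i (delta lam dA scaleV dV n f) xs))"
      by (intro sum.cong refl arg_cong[where f = "scaleV c" for c] coface_cong)
         (simp_all add: delta_eq[OF f] True)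
    also have "\<dots> = hochschild_lam scaleA lam dA scaleV lact ract n (delta lam dA scaleV dV n f) xs"
      by (simp only: hochschild_lam_def hoch True)
    finally show ?thesis .
  qed (simp add: hochschild_lam_def hochschild_def delta_def)
qed

lemma delta_in_cochains:
  assumes f: "multilinear scaleA scaleV n f"
  shows "delta lam dA scaleV dV n f \<in> cochains scaleA scaleV n"
  unfolding cochains_iff
proof
  show "multilinear scaleA scaleV n (delta lam dA scaleV dV n f)"
    unfolding multilinear_def
  proof (intro allI impI)
    fix xs :: "'a list" and i assume xs: "length xs = n" and i: "i < n"
    have "Vector_Spaces.linear scaleA scaleA (\<lambda>x. if b then dA x else x)" for b
      using linear_dA A.linear_ident by (cases b) simp_all
    then have "Vector_Spaces.linear scaleA scaleV (\<lambda>x. f (apply_on I dA (xs[i := x])))" for I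
      using xs i by (simp add: apply_on_update multilinear_update[OF f])
    moreover have "Vector_Spaces.linear scaleA scaleV (\<lambda>x. dV (f (xs[i := x])))"
      by (rule linear_comp[OF _ linear_dV]) (use f xs i in \<open>auto simp: multilinear_def\<close>)
    \<comment> \<open>In the subset form the changed entry enters each summand once, through
      \<open>dA\<close> or the identity, so linearity is inherited; \<open>D_subsets\<close> then
      converts to \<open>D\<close>.\<close>
    ultimately have "Vector_Spaces.linear scaleA scaleV (\<lambda>x.
        (\<Sum>I\<in>Pow {..<n} - {{}}. scaleV (lam ^ (card I - 1)) (f (apply_on I dA (xs[i := x]))))
        - dV (f (xs[i := x])))"
      by (intro AV.linear_compose_sub AV.linear_compose_sum ballI AV.linear_compose_scale_right) auto
    then show "Vector_Spaces.linear scaleA scaleV (\<lambda>x. delta lam dA scaleV dV n f (xs[i := x]))"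
      using xs by (simp only: delta_eq[OF f] D_subsets[OF f] length_list_update)
  qed
qed (simp add: delta_def)

lemma delta_add: "delta lam dA scaleV dV n (f + g) = delta lam dA scaleV dV n f + delta lam dA scaleV dV n g"
  by (auto simp: delta_def fun_eq_iff dV_simps V.scale_right_distrib sum.distrib)

lemma delta_scale:
  "delta lam dA scaleV dV n (scale_fun scaleV c f) = scale_fun scaleV c (delta lam dA scaleV dV n f)"
  by (auto simp: delta_def scale_fun_def fun_eq_iff dV_simps V.scale_right_diff_distrib
      V.scale_sum_right mult.commute)

end


section \<open>The total complex\<close>

lemma vector_space_scale_DA:
  assumes "vector_space s"
  shows "vector_space (scale_DA s)"
proof -
  interpret vector_space s by fact
  show ?thesis
    by unfold_locales
       (auto simp: scale_DA_def scale_fun_def fun_eq_iff scale_right_distrib scale_left_distrib)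
qed

lemma (in vector_space_pair) multilinear_subspace:
  "multilinear s1 s2 n (\<lambda>xs. 0)"
  "multilinear s1 s2 n f \<Longrightarrow> multilinear s1 s2 n g \<Longrightarrow> multilinear s1 s2 n (\<lambda>xs. f xs + g xs)"
  "multilinear s1 s2 n f \<Longrightarrow> multilinear s1 s2 n (\<lambda>xs. s2 c (f xs))"
  by (auto simp: multilinear_def intro!: linear_zero linear_compose_add linear_compose_scale_right)

lemma (in vector_space_pair) cochains_subspace:
  "0 \<in> cochains s1 s2 n"
  "f \<in> cochains s1 s2 n \<Longrightarrow> g \<in> cochains s1 s2 n \<Longrightarrow> f + g \<in> cochains s1 s2 n"
  "f \<in> cochains s1 s2 n \<Longrightarrow> scale_fun s2 c f \<in> cochains s1 s2 n"
  by (auto simp: cochains_iff scale_fun_def plus_fun_def zero_fun_def multilinear_subspace)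

theorem theorem3p5:
  fixes scaleA :: "'k::field_char_0 \<Rightarrow> 'a::ring \<Rightarrow> 'a"
    and lam :: 'k
    and dA :: "'a \<Rightarrow> 'a"
    and scaleV :: "'k \<Rightarrow> 'v::ab_group_add \<Rightarrow> 'v"
    and lact :: "'a \<Rightarrow> 'v \<Rightarrow> 'v"
    and ract :: "'v \<Rightarrow> 'a \<Rightarrow> 'v"
    and dV :: "'v \<Rightarrow> 'v"
  assumes "differential_algebra scaleA lam dA"
    and "differential_bimodule scaleA lam dA scaleV lact ract dV"
  shows "cochain_complex (scale_DA scaleV) (cochains_DA scaleA scaleV)
           (diff_DA scaleA lam dA scaleV lact ract dV)"
proof -
  interpret differential_bimodule scaleA lam dA scaleV lact ract dV by fact
  interpret AV: vector_space_pair scaleA scaleV ..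
  interpret L: assoc_bimodule scaleA scaleV "lact_lam scaleA lam dA lact" "ract_lam scaleA lam dA ract"
    by (rule bimodule_lam)
  interpret DA: vector_space "scale_DA scaleV"
    by (rule vector_space_scale_DA) (rule V.vector_space_axioms)
  let ?d = "diff_DA scaleA lam dA scaleV lact ract dV"
  let ?s = "scale_fun scaleV"
  let ?C = "cochains_DA scaleA scaleV"
  let ?h = "hochschild_lam scaleA lam dA scaleV lact ract"
  let ?\<delta> = "delta lam dA scaleV dV"
  \<comment> \<open>The Hochschild facts for the twisted actions; folding turns them into facts
    about \<open>hochschild_lam\<close>.\<close>
  note lam_facts = L.hochschild_add L.hochschild_scale L.hochschild_hochschild L.hochschild_in_cochains
  note hl = lam_facts[folded hochschild_lam_def]
  have s_simps: "?s c (f + g) = ?s c f + ?s c g" "?s c (?s e f) = ?s (c * e) f" "?s c 0 = 0"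
    for c e f and g :: "'a list \<Rightarrow> 'v"
    by (auto simp: scale_fun_def fun_eq_iff V.scale_right_distrib)
  have subspace: "DA.subspace (?C n)" for n
    by (cases n)
       (auto simp: DA.subspace_def scale_DA_def AV.cochains_subspace zero_prod_def s_simps)
  have maps: "?d n x \<in> ?C (Suc n)" if x: "x \<in> ?C n" for n x
  proof -
    obtain f g where fg: "x = (f, g)" by (cases x)
    then have f: "multilinear scaleA scaleV n f"
      using x by (cases n) (auto simp: cochains_iff)
    show ?thesis
    proof (cases n)
      case 0
      then show ?thesis
        using hochschild_in_cochains[OF f] delta_in_cochains[OF f] by (simp add: fg)
    next
      case (Suc m)
      then have "multilinear scaleA scaleV m g"
        using x fg by (simp add: cochains_iff)
      from hl(4)[OF this] show ?thesis
        using hochschild_in_cochains[OF f] delta_in_cochains[OF f]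
        by (simp add: fg Suc AV.cochains_subspace)
    qed
  qed
  have add: "?d n (x + y) = ?d n x + ?d n y" for n x y
    by (cases n; cases x; cases y) (simp_all add: hochschild_add hl delta_add s_simps)
  have scale: "?d n (scale_DA scaleV c x) = scale_DA scaleV c (?d n x)" for n c x
    by (cases n; cases x)
       (simp_all add: scale_DA_def hochschild_scale hl delta_scale s_simps mult.commute)
  have square: "?d (Suc n) (?d n x) = 0" if x: "x \<in> ?C n" for n x
  proof -
    obtain f g where fg: "x = (f, g)" by (cases x)
    then have f: "multilinear scaleA scaleV n f"
      using x by (cases n) (auto simp: cochains_iff)
    \<comment> \<open>Consecutive degrees carry opposite signs, so the mixed terms take this shape
      once \<open>delta_hochschild\<close> has identified them.\<close>
    have cancel: "?s (- c) u + ?s c u = 0" for c and u :: "'a list \<Rightarrow> 'v"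
      by (simp add: scale_fun_def fun_eq_iff)
    show ?thesis
    proof (cases n)
      case 0
      \<comment> \<open>From degree 0 to 1 \<open>delta\<close> carries no sign, while the next
        differential contributes \<open>- 1\<close>.\<close>
      have "?h 0 (?\<delta> 0 f) + ?s (- 1) (?h 0 (?\<delta> 0 f)) = 0"
        by (simp add: scale_fun_def fun_eq_iff)
      then show ?thesis
        using 0 f by (simp add: fg hochschild_hochschild delta_hochschild zero_prod_def)
    next
      case (Suc m)
      then show ?thesis
        using f
        by (simp add: fg hochschild_hochschild delta_hochschild hl zero_prod_def cancel)
    qed
  qed
  show ?thesis
    unfolding cochain_complex_def
    by (intro conjI allI ballI image_subsetI DA.vector_space_axioms subspace maps add scale square)
qed

end
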